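(* Let $G$ be an undirected graph with $N$ vertices. The variance of the mp-chart $H_G$ of $G$ is $$\mathbb{V}(H_G)= \sum_{i=1}^N \frac {d_i(N-d_i)} {N^2} + \sum_{\substack{i,j=1 \\ i \ne j}}^N \frac {d_id_j - N\,T_{i,j}} {N^2(N-1)},$$ where $d_1,\ldots,d_N$ are the degrees of the vertices and $T_{i,j}=\langle r_i,r_j\rangle$ is the scalar product of the $i$-th row $r_i$ and the $j$-th row $r_j$ of the adjacency matrix $A_G$.
   Context: Graphs are finite, undirected and without loops (and without multiple edges), with $N\ge 1$ vertices labelled $1,\dots,N$. The adjacency matrix $A_G$ of $G=(V,E)$ is the symmetric $N\times N$ matrix with $(A_G)_{i,j}=1$ if $(i,j)\in E$ and $0$ otherwise; its diagonal entries are zero. For $0\le k\le N$, $h_G(k)$ is the number of permutations $\pi$ of $\{1,\dots,N\}$ such that $\sum_{i=1}^N (A_G)_{i,\pi(i)}=k$. The mp-chart of $G$ is the vector $H_G=(h_G(0),\dots,h_G(N))$. Normalized by $N!$, it is the probability distribution of $S_N(\pi)=\sum_{i=1}^N (A_G)_{i,\pi(i)}$ for $\pi$ a uniformly random permutation of $\{1,\dots,N\}$; $\mathbb{V}(H_G)$ denotes the variance of this distribution. The second sum is over ordered pairs $(i,j)$ with $i\neq j$; it is empty (equal to $0$) when $N=1$. *)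

theory Defs
  imports
    "HOL-Probability.Probability"
    "Graph_Theory.Pair_Digraph"
    "Jordan_Normal_Form.Matrix"
begin

text \<open>
  Finite simple undirected graphs are the symmetric loop-free digraphs without parallel arcs of
  the locale \<^locale>\<open>pair_graph\<close>: an edge between i and j is represented by the two arcs (i, j)
  and (j, i). Matrix indices start at 0, so a graph on N vertices has the vertex set
  0, ..., N - 1 throughout.
\<close>

definition num_verts :: "nat pair_pre_digraph \<Rightarrow> nat" where
  "num_verts G = card (pverts G)"

definition adj_mat :: "nat pair_pre_digraph \<Rightarrow> real mat" where
  "adj_mat G =
     mat (num_verts G) (num_verts G) (\<lambda>(i, j). if (i, j) \<in> parcs G then 1 else 0)"

text \<open>Each edge at v contributes exactly one arc that leaves v.\<close>

definition vertex_degree :: "nat pair_pre_digraph \<Rightarrow> nat \<Rightarrow> nat" where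
  "vertex_degree G v = out_degree (with_proj G) v"

definition perm_weight :: "nat pair_pre_digraph \<Rightarrow> (nat \<Rightarrow> nat) \<Rightarrow> real" where
  "perm_weight G \<pi> = (\<Sum>i<num_verts G. adj_mat G $$ (i, \<pi> i))"

definition mp_count :: "nat pair_pre_digraph \<Rightarrow> nat \<Rightarrow> nat" where
  "mp_count G k = card {\<pi>. \<pi> permutes {..<num_verts G} \<and> perm_weight G \<pi> = real k}"

definition mp_chart :: "nat pair_pre_digraph \<Rightarrow> nat vec" where
  "mp_chart G = vec (num_verts G + 1) (mp_count G)"

text \<open>
  A chart of a graph on N vertices has N + 1 entries, which sum to the number of permutations.
\<close>

definition chart_pmf :: "nat vec \<Rightarrow> nat pmf" where
  "chart_pmf H =
     embed_pmf (\<lambda>k. if k < dim_vec H then real (H $ k) / fact (dim_vec H - 1) else 0)"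

definition chart_variance :: "nat vec \<Rightarrow> real" where
  "chart_variance H = measure_pmf.variance (chart_pmf H) real"

text \<open>
  \<^const>\<open>embed_pmf\<close> is only meaningful for a nonnegative function of total mass 1. This is the
  case for the normalized chart of a graph, which is the distribution of the weight of a
  uniformly random permutation.
\<close>

lemma
  shows pmf_chart_pmf: "pmf (chart_pmf (mp_chart G)) k =
      (if k \<le> num_verts G then real (mp_count G k) / fact (num_verts G) else 0)"
    and chart_pmf_mp_chart: "map_pmf real (chart_pmf (mp_chart G)) =
      map_pmf (perm_weight G) (pmf_of_set {\<pi>. \<pi> permutes {..<num_verts G}})"
proof -
  define N where "N = num_verts G"
  define P where "P = {\<pi>. \<pi> permutes {..<N}}"
  define s where "s \<pi> = card {i \<in> {..<N}. (i, \<pi> i) \<in> parcs G}" for \<pi> :: "nat \<Rightarrow> nat"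
  define q where "q = map_pmf s (pmf_of_set P)"
  have P: "finite P" "P \<noteq> {}" "card P = fact N"
    unfolding P_def
    by (auto simp: finite_permutations card_permutations intro: permutes_id)
  have s_le: "s \<pi> \<le> N" for \<pi>
    unfolding s_def by (rule order.trans[OF card_mono[of "{..<N}"]]) auto
  have weight: "perm_weight G \<pi> = real (s \<pi>)" if "\<pi> \<in> P" for \<pi>
  proof -
    have "perm_weight G \<pi> = (\<Sum>i<N. if (i, \<pi> i) \<in> parcs G then 1 else 0)"
      unfolding perm_weight_def N_def[symmetric]
    proof (rule sum.cong)
      fix i assume "i \<in> {..<N}"
      moreover from this have "\<pi> i < N"
        using that by (metis P_def mem_Collect_eq lessThan_iff permutes_in_image)
      ultimately show "adj_mat G $$ (i, \<pi> i) = (if (i, \<pi> i) \<in> parcs G then 1 else 0)"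
        by (simp add: adj_mat_def N_def)
    qed simp
    also have "\<dots> = real (s \<pi>)"
      by (simp add: s_def sum.If_cases Int_def)
    finally show ?thesis .
  qed
  have count: "mp_count G k = card (P \<inter> s -` {k})" for k
  proof -
    have "{\<pi>. \<pi> permutes {..<num_verts G} \<and> perm_weight G \<pi> = real k} = P \<inter> s -` {k}"
      using weight by (auto simp: P_def N_def)
    then show ?thesis
      by (simp add: mp_count_def)
  qed
  have pmf_q: "pmf q k = (if k \<le> N then real (mp_count G k) / fact N else 0)" for k
  proof -
    have "pmf q k = real (card (P \<inter> s -` {k})) / fact N"
      by (simp add: q_def pmf_map measure_pmf_of_set P)
    moreover have "P \<inter> s -` {k} = {}" if "\<not> k \<le> N"
      using that s_le by auto
    ultimately show ?thesis
      by (auto simp: count)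
  qed
  have "chart_pmf (mp_chart G) = embed_pmf (pmf q)"
    unfolding chart_pmf_def
    by (rule arg_cong[where f = embed_pmf]) (auto simp: fun_eq_iff pmf_q mp_chart_def N_def)
  also have "\<dots> = q"
    by (rule type_definition.Rep_inverse[OF td_pmf_embed_pmf])
  finally have q: "chart_pmf (mp_chart G) = q" .
  show "pmf (chart_pmf (mp_chart G)) k =
      (if k \<le> num_verts G then real (mp_count G k) / fact (num_verts G) else 0)"
    by (simp add: q pmf_q N_def)
  have "map_pmf real q = map_pmf (perm_weight G) (pmf_of_set P)"
    unfolding q_def pmf.map_comp
    by (rule map_pmf_cong) (auto simp: weight P)
  then show "map_pmf real (chart_pmf (mp_chart G)) =
      map_pmf (perm_weight G) (pmf_of_set {\<pi>. \<pi> permutes {..<num_verts G}})"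
    by (simp add: q P_def N_def)
qed

end

theory Submission
  imports Defs
begin

text \<open>
  The weight of a permutation \<open>\<pi>\<close> is Hoeffding's combinatorial statistic
  \<open>\<Sum>i. a i (\<pi> i)\<close> for the matrix \<open>a\<close>. Its variance only involves the joint laws of
  one or two values of a uniformly random permutation of a set of n elements: \<open>\<pi> i\<close> is uniform
  on the set, and for \<open>i \<noteq> j\<close> the pair \<open>(\<pi> i, \<pi> j)\<close> is uniform on the \<open>n (n - 1)\<close> pairs of
  distinct elements (\<open>expectation_perm_apply\<close> and \<open>expectation_perm_apply2\<close>). Hence, with the
  row sums \<open>R i\<close> of \<open>a\<close>, the summands have mean \<open>R i / n\<close>, and the product of two different
  summands has mean \<open>(R i * R j - \<langle>a i, a j\<rangle>) / (n (n - 1))\<close>, since the product of the row sums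
  also counts the excluded diagonal pairs. Subtracting the products of means gives the covariances,
  which add up to the variance.

  For an adjacency matrix the row sums are the degrees, and the squares of the entries are
  the entries themselves, so that the variance of a single summand is \<open>d (n - d) / n\<^sup>2\<close>.
\<close>

section \<open>Values of a uniformly random permutation\<close>

abbreviation uniform_perm :: "'a set \<Rightarrow> ('a \<Rightarrow> 'a) pmf" where
  "uniform_perm A \<equiv> pmf_of_set {\<pi>. \<pi> permutes A}"

lemma finite_nonempty_perms:
  assumes "finite A"
  shows "finite {\<pi>. \<pi> permutes A}" "{\<pi>. \<pi> permutes A} \<noteq> {}"
  using assms by (auto simp: finite_permutations intro: permutes_id)

lemma expectation_uniform_perm:
  fixes g :: "('a \<Rightarrow> 'a) \<Rightarrow> real"
  assumes "finite A"
  shows "measure_pmf.expectation (uniform_perm A) g =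
    (\<Sum>\<pi> | \<pi> permutes A. g \<pi>) / fact (card A)"
  using integral_pmf_of_set[OF finite_nonempty_perms(2,1)[OF assms], of g] assms
  by (simp add: card_permutations)

lemma integrable_uniform_perm:
  fixes g :: "('a \<Rightarrow> 'a) \<Rightarrow> real"
  assumes "finite A"
  shows "integrable (uniform_perm A) g"
  by (intro integrable_measure_pmf_finite)
    (simp only: set_pmf_of_set[OF finite_nonempty_perms(2,1)[OF assms]] finite_nonempty_perms assms)

text \<open>
  A permutation of \<open>A\<close> is determined by the image b of i and a permutation of the other
  elements, followed by the exchange of i and b. Since every choice of b leaves the same number of
  permutations, the image of i is uniform.
\<close>

lemma expectation_perm_apply:
  fixes f :: "'a \<Rightarrow> real"
  assumes "finite A" and "i \<in> A"
  shows "measure_pmf.expectation (uniform_perm A) (\<lambda>\<pi>. f (\<pi> i)) = (\<Sum>k\<in>A. f k) / card A"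
proof -
  define S where "S = A - {i}"
  have A: "A = insert i S" "finite S" "i \<notin> S"
    using assms by (auto simp: S_def)
  have "(\<Sum>\<pi> | \<pi> permutes A. f (\<pi> i)) = (\<Sum>b\<in>A. \<Sum>q | q permutes S. f b)"
    unfolding A(1) sum_over_permutations_insert[OF A(2,3)]
    using A(3) by (intro sum.cong refl) (simp add: permutes_not_in)
  also have "\<dots> = fact (card S) * (\<Sum>b\<in>A. f b)"
    using A(2) by (simp add: card_permutations sum_distrib_left)
  finally show ?thesis
    using A assms(1) by (simp add: expectation_uniform_perm)
qed

text \<open>
  Under the same decomposition, the image of j before the exchange is uniform on the set
  without i, and exchanging i and b maps that set bijectively to the set without b.
\<close>

lemma expectation_perm_apply2:
  fixes f :: "'a \<Rightarrow> 'a \<Rightarrow> real"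
  assumes "finite A" and "i \<in> A" and "j \<in> A" and "i \<noteq> j"
  shows "measure_pmf.expectation (uniform_perm A) (\<lambda>\<pi>. f (\<pi> i) (\<pi> j)) =
    (\<Sum>k\<in>A. \<Sum>l\<in>A - {k}. f k l) / (card A * (real (card A) - 1))"
proof -
  define S where "S = A - {i}"
  have A: "A = insert i S" "finite S" "i \<notin> S" and j: "j \<in> S"
    using assms by (auto simp: S_def)
  have "card S > 0"
    using A(2) j by (auto simp: card_gt_0_iff)
  have inner: "(\<Sum>q | q permutes S. f b (Transposition.transpose i b (q j))) =
      fact (card S) / card S * (\<Sum>l\<in>A - {b}. f b l)" if "b \<in> A" for b
  proof -
    have "bij_betw (Transposition.transpose i b) S (A - {b})"
      using that A by (intro bij_betwI[where g = "Transposition.transpose i b"])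
        (auto simp: Transposition.transpose_def split: if_splits)
    then have "(\<Sum>l\<in>S. f b (Transposition.transpose i b l)) = (\<Sum>l\<in>A - {b}. f b l)"
      by (rule sum.reindex_bij_betw)
    then show ?thesis
      using expectation_perm_apply[OF A(2) j, of "\<lambda>l. f b (Transposition.transpose i b l)"]
      by (simp add: expectation_uniform_perm[OF A(2)] field_simps)
  qed
  have "(\<Sum>\<pi> | \<pi> permutes A. f (\<pi> i) (\<pi> j)) =
      (\<Sum>b\<in>A. \<Sum>q | q permutes S. f b (Transposition.transpose i b (q j)))"
    unfolding A(1) sum_over_permutations_insert[OF A(2,3)]
    using A(3) by (intro sum.cong refl) (simp add: permutes_not_in)
  also have "\<dots> = fact (card S) / card S * (\<Sum>b\<in>A. \<Sum>l\<in>A - {b}. f b l)"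
    by (simp add: inner sum_distrib_left)
  finally show ?thesis
    using A assms(1) \<open>card S > 0\<close> by (simp add: expectation_uniform_perm)
qed

section \<open>The variance of the combinatorial statistic\<close>

text \<open>
  Expanding the square of the sum turns the variance into the sum of all covariances of two
  summands; the diagonal terms are the variances of the summands. In the off-diagonal terms,
  \<open>1 / (n (n - 1)) - 1 / n\<^sup>2 = 1 / (n\<^sup>2 (n - 1))\<close> is the coefficient of \<open>R i * R j\<close>.
\<close>

lemma variance_perm_statistic:
  fixes a :: "'a \<Rightarrow> 'a \<Rightarrow> real"
  assumes "finite A"
  defines "n \<equiv> real (card A)" and "R \<equiv> \<lambda>i. \<Sum>k\<in>A. a i k"
  shows "measure_pmf.variance (uniform_perm A) (\<lambda>\<pi>. \<Sum>i\<in>A. a i (\<pi> i)) =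
      (\<Sum>i\<in>A. (\<Sum>k\<in>A. (a i k)\<^sup>2) / n - (R i / n)\<^sup>2)
    + (\<Sum>i\<in>A. \<Sum>j\<in>A - {i}. (R i * R j - n * (\<Sum>k\<in>A. a i k * a j k)) / (n\<^sup>2 * (n - 1)))"
proof -
  let ?E = "measure_pmf.expectation (uniform_perm A)"
  have int: "integrable (uniform_perm A) g" for g :: "('a \<Rightarrow> 'a) \<Rightarrow> real"
    using assms(1) by (rule integrable_uniform_perm)
  have mean: "?E (\<lambda>\<pi>. \<Sum>i\<in>A. a i (\<pi> i)) = (\<Sum>i\<in>A. R i / n)"
    by (simp add: int expectation_perm_apply assms(1) R_def n_def)
  have cov: "?E (\<lambda>\<pi>. a i (\<pi> i) * a j (\<pi> j)) - R i / n * (R j / n) =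
      (R i * R j - n * (\<Sum>k\<in>A. a i k * a j k)) / (n\<^sup>2 * (n - 1))"
    if "i \<in> A" "j \<in> A - {i}" for i j
  proof -
    \<comment> \<open>Two distinct indices exist, so the denominator \<open>n - 1\<close> is nonzero.\<close>
    have "card {i, j} \<le> card A"
      using that assms(1) by (intro card_mono) auto
    then have n: "n \<ge> 2"
      using that by (auto simp: n_def)
    have "(\<Sum>k\<in>A. \<Sum>l\<in>A - {k}. a i k * a j l) = (\<Sum>k\<in>A. a i k * R j - a i k * a j k)"
      using assms(1)
      by (intro sum.cong refl) (simp add: sum_diff1 R_def sum_distrib_left)
    also have "\<dots> = R i * R j - (\<Sum>k\<in>A. a i k * a j k)"
      by (simp add: sum_subtractf R_def sum_distrib_right)
    finally have E: "?E (\<lambda>\<pi>. a i (\<pi> i) * a j (\<pi> j)) =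
        (R i * R j - (\<Sum>k\<in>A. a i k * a j k)) / (n * (n - 1))"
      using that assms(1) expectation_perm_apply2[of A i j "\<lambda>k l. a i k * a j l"]
      by (auto simp: n_def)
    show ?thesis
      unfolding E
      using n by (simp add: divide_simps power2_eq_square) (simp add: algebra_simps)
  qed
  have var: "?E (\<lambda>\<pi>. a i (\<pi> i) * a i (\<pi> i)) - R i / n * (R i / n) =
      (\<Sum>k\<in>A. (a i k)\<^sup>2) / n - (R i / n)\<^sup>2" if "i \<in> A" for i
    using that expectation_perm_apply[OF assms(1), of i "\<lambda>k. a i k * a i k"]
    by (simp add: n_def power2_eq_square)
  have "measure_pmf.variance (uniform_perm A) (\<lambda>\<pi>. \<Sum>i\<in>A. a i (\<pi> i)) =
      ?E (\<lambda>\<pi>. (\<Sum>i\<in>A. a i (\<pi> i))\<^sup>2) - (\<Sum>i\<in>A. R i / n)\<^sup>2"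
    by (subst measure_pmf.variance_eq[OF int int]) (simp only: mean)
  also have "\<dots> = (\<Sum>i\<in>A. \<Sum>j\<in>A. ?E (\<lambda>\<pi>. a i (\<pi> i) * a j (\<pi> j)) - R i / n * (R j / n))"
    by (simp add: power2_eq_square sum_product int sum_subtractf)
  also have "\<dots> = (\<Sum>i\<in>A. (?E (\<lambda>\<pi>. a i (\<pi> i) * a i (\<pi> i)) - R i / n * (R i / n)) +
      (\<Sum>j\<in>A - {i}. ?E (\<lambda>\<pi>. a i (\<pi> i) * a j (\<pi> j)) - R i / n * (R j / n)))"
    using assms(1) by (intro sum.cong refl sum.remove)
  also have "\<dots> = (\<Sum>i\<in>A. (\<Sum>k\<in>A. (a i k)\<^sup>2) / n - (R i / n)\<^sup>2)
    + (\<Sum>i\<in>A. \<Sum>j\<in>A - {i}. (R i * R j - n * (\<Sum>k\<in>A. a i k * a j k)) / (n\<^sup>2 * (n - 1)))"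
    by (simp only: sum.distrib var cov cong: sum.cong)
  finally show ?thesis .
qed

section \<open>Graphs\<close>

lemma chart_variance_mp_chart:
  "chart_variance (mp_chart G) =
    measure_pmf.variance (uniform_perm {..<num_verts G}) (perm_weight G)"
proof -
  have "measure_pmf.expectation (chart_pmf (mp_chart G)) (\<lambda>k. g (real k)) =
      measure_pmf.expectation (uniform_perm {..<num_verts G}) (\<lambda>\<pi>. g (perm_weight G \<pi>))"
    for g :: "real \<Rightarrow> real"
    using arg_cong[OF chart_pmf_mp_chart[of G], of "\<lambda>p. measure_pmf.expectation p g"]
    by simp
  from this[of "\<lambda>x. x"] this show ?thesis
    by (simp add: chart_variance_def)
qed

lemma vertex_degree_eq_row_sum:
  assumes "pair_graph G" and "pverts G = {..<N}" and "i < N"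
  shows "real (vertex_degree G i) = (\<Sum>k<N. adj_mat G $$ (i, k))"
proof -
  interpret pair_graph G by fact
  have "k < N" if "(i, k) \<in> parcs G" for k
    using in_arcsD2[OF that] assms(2) by simp
  then have "out_arcs (with_proj G) i = Pair i ` {k \<in> {..<N}. (i, k) \<in> parcs G}"
    unfolding out_arcs_def by force
  then have "vertex_degree G i = card {k \<in> {..<N}. (i, k) \<in> parcs G}"
    by (simp add: vertex_degree_def out_degree_def card_image inj_on_def)
  moreover have "(\<Sum>k<N. adj_mat G $$ (i, k)) = (\<Sum>k<N. if (i, k) \<in> parcs G then 1 else 0)"
    using assms by (intro sum.cong) (auto simp: adj_mat_def num_verts_def)
  ultimately show ?thesis
    by (simp add: sum.If_cases Int_def)
qed

theorem theorem3p5: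
  fixes G :: "nat pair_pre_digraph" and N :: nat
    and d :: "nat \<Rightarrow> real" and T :: "nat \<Rightarrow> nat \<Rightarrow> real"
  assumes "pair_graph G" and "N \<ge> 1" and "pverts G = {..<N}"
  defines "d \<equiv> \<lambda>i. real (vertex_degree G i)"
    and "T \<equiv> \<lambda>i j. scalar_prod (row (adj_mat G) i) (row (adj_mat G) j)"
  shows "chart_variance (mp_chart G) =
      (\<Sum>i<N. d i * (real N - d i) / real N ^ 2)
    + (\<Sum>(i, j) \<in> {(i, j). i < N \<and> j < N \<and> i \<noteq> j}.
         (d i * d j - real N * T i j) / (real N ^ 2 * (real N - 1)))"
proof -
  define a where "a i j = adj_mat G $$ (i, j)" for i j
  have N: "num_verts G = N"
    using assms(3) by (simp add: num_verts_def)
  have d: "(\<Sum>k<N. a i k) = d i" if "i < N" for i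
    using vertex_degree_eq_row_sum[OF assms(1,3) that] by (simp add: a_def d_def)
  have T: "(\<Sum>k<N. a i k * a j k) = T i j" if "i < N" "j < N" for i j
    using that by (simp add: T_def a_def scalar_prod_def adj_mat_def N lessThan_atLeast0)
  \<comment> \<open>The entries are 0 or 1, hence equal to their squares.\<close>
  have sq: "(\<Sum>k<N. (a i k)\<^sup>2) = d i" if "i < N" for i
    unfolding d[OF that, symmetric]
    using that by (intro sum.cong) (auto simp: a_def adj_mat_def N)
  have pairs: "{(i, j). i < N \<and> j < N \<and> i \<noteq> j} = Sigma {..<N} (\<lambda>i. {..<N} - {i})"
    by auto
  have weight: "perm_weight G = (\<lambda>\<pi>. \<Sum>i<N. a i (\<pi> i))"
    by (simp add: fun_eq_iff perm_weight_def N a_def)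
  have "chart_variance (mp_chart G) =
      measure_pmf.variance (uniform_perm {..<N}) (\<lambda>\<pi>. \<Sum>i<N. a i (\<pi> i))"
    by (simp add: chart_variance_mp_chart weight N)
  also have "\<dots> = (\<Sum>i<N. d i / N - (d i / N)\<^sup>2)
      + (\<Sum>i<N. \<Sum>j\<in>{..<N} - {i}. (d i * d j - N * T i j) / ((real N)\<^sup>2 * (real N - 1)))"
    by (subst variance_perm_statistic) (simp_all add: d T sq)
  also have "(\<Sum>i<N. d i / N - (d i / N)\<^sup>2) = (\<Sum>i<N. d i * (real N - d i) / real N ^ 2)"
    using assms(2) by (intro sum.cong refl) (simp add: field_simps power2_eq_square)
  finally show ?thesis
    by (simp add: pairs sum.Sigma)
qed

end
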